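(* Let $G = K \rtimes_\theta Q \neq 1$. Then $G$ is not icc if and only if at least one of the following conditions is satisfied: \begin{itemize} \item[(i)] $K$ contains a normal subgroup $N \neq 1$ preserved under the action of $\pi(G)$ and such that either $N$ is finite, or $N \cong \mathbb{Z}^n$ (for some $n$) has only finite $\pi(G)$-orbits; \item[(ii.a)] the restricted homomorphism $\theta : FC(Q) \to \mathrm{Aut}(K)$ is non-injective; \item[(ii.b)] $G$ contains a twin $FC$-subfactor. \end{itemize}
   Context: A group is icc (has infinite conjugacy classes) if it is non-trivial and all its conjugacy classes other than $\{1\}$ are infinite. For a group $H$, $FC(H)$ denotes the (characteristic) subgroup of all elements of $H$ whose conjugacy class in $H$ is finite. $G = K \rtimes_\theta Q$ denotes the split extension (semi-direct product) with normal factor $K$, retract factor $Q$ (both viewed as subgroups of $G$) and associated homomorphism $\theta : Q \to \mathrm{Aut}(K)$, with the convention $q^{-1} k q = \theta(q)(k)$ for $k \in K$, $q \in Q$. The homomorphism $\pi : G \to \mathrm{Aut}(K)$ is defined by $\pi(g)(k) = g^{-1} k g$ for $g \in G$, $k \in K$; it extends $\theta$. (Composition in $\mathrm{Aut}(K)$ is taken in the order that makes these maps homomorphisms.) Orbits are those of the natural actions of the subgroups $\theta(Q), \pi(G) \le \mathrm{Aut}(K)$ on $K$. Definition. $C \rtimes C'$ is a twin $FC$-subfactor of $G = K \rtimes_\theta Q$ when: (1) $C$ is a subgroup of $K$ and $C \cap FC(K) = 1$; (2) $C$ is $\theta(Q)$-stable, with only finite $\theta(Q)$-orbits; (3) $C'$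 is a normal subgroup of $Q$ and $C' \subset FC(Q)$; (4) $\pi$ is injective on $C$, $\theta$ is injective on $C'$, and $\pi(C) = \theta(C')$ (so that $\theta^{-1} \circ \pi|_C : C \to C'$ is an isomorphism); (5) $C \neq 1$, and $C$ is either finite or isomorphic to $\mathbb{Z}^n$ for some $n$. *)

theory Defs
  imports "HOL-Algebra.Algebra"
begin

definition conj_class :: "('a, 'm) monoid_scheme \<Rightarrow> 'a \<Rightarrow> 'a set" where
  "conj_class G x = {inv\<^bsub>G\<^esub> g \<otimes>\<^bsub>G\<^esub> x \<otimes>\<^bsub>G\<^esub> g | g. g \<in> carrier G}"

definition icc :: "('a, 'm) monoid_scheme \<Rightarrow> bool" where
  "icc G \<longleftrightarrow> carrier G \<noteq> {\<one>\<^bsub>G\<^esub>} \<and>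
     (\<forall>x \<in> carrier G. x \<noteq> \<one>\<^bsub>G\<^esub> \<longrightarrow> infinite (conj_class G x))"

definition FC :: "('a, 'm) monoid_scheme \<Rightarrow> 'a set" where
  "FC G = {x \<in> carrier G. finite (conj_class G x)}"

abbreviation sub :: "('a, 'm) monoid_scheme \<Rightarrow> 'a set \<Rightarrow> ('a, 'm) monoid_scheme" where
  "sub G H \<equiv> G\<lparr>carrier := H\<rparr>"

definition int_power :: "nat \<Rightarrow> (nat \<Rightarrow> int) monoid" where
  "int_power n = product_group {..<n} (\<lambda>_. integer_group)"

text \<open>
  The library's \<open>AutoGroup\<close> multiplies by \<open>f \<otimes> g = f \<circ> g\<close>. Conjugation is taken here in the form
  \<open>k \<mapsto> g\<^sup>-\<^sup>1 k g\<close>, which is a homomorphism for the opposite order: first \<open>f\<close>, then \<open>g\<close>.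
  Automorphisms are extensional functions, so equality and injectivity of maps into \<open>Aut K\<close>
  only depend on values on \<open>carrier K\<close>.
\<close>

definition Aut :: "('a, 'm) monoid_scheme \<Rightarrow> ('a \<Rightarrow> 'a) monoid" where
  "Aut K = \<lparr>carrier = auto K,
            monoid.mult = (\<lambda>f g. compose (carrier K) g f),
            one = (\<lambda>x \<in> carrier K. x)\<rparr>"

definition conj_action :: "('a, 'm) monoid_scheme \<Rightarrow> 'a set \<Rightarrow> 'a \<Rightarrow> 'a \<Rightarrow> 'a" where
  "conj_action G K g = (\<lambda>k \<in> K. inv\<^bsub>G\<^esub> g \<otimes>\<^bsub>G\<^esub> k \<otimes>\<^bsub>G\<^esub> g)"

text \<open>\<open>split_extension G K Q \<theta>\<close> says that \<open>G\<close> is the semidirect product of its subgroups \<open>K\<close>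
  (the normal factor) and \<open>Q\<close> (the retract factor), with associated homomorphism \<open>\<theta>\<close>.\<close>

definition split_extension ::
    "('a, 'm) monoid_scheme \<Rightarrow> 'a set \<Rightarrow> 'a set \<Rightarrow> ('a \<Rightarrow> 'a \<Rightarrow> 'a) \<Rightarrow> bool" where
  "split_extension G K Q \<theta> \<longleftrightarrow>
     group G \<and> K \<lhd> G \<and> subgroup Q G \<and>
     K \<inter> Q = {\<one>\<^bsub>G\<^esub>} \<and> K <#>\<^bsub>G\<^esub> Q = carrier G \<and>
     \<theta> \<in> hom (sub G Q) (Aut (sub G K)) \<and>
     (\<forall>q \<in> Q. \<forall>k \<in> K. inv\<^bsub>G\<^esub> q \<otimes>\<^bsub>G\<^esub> k \<otimes>\<^bsub>G\<^esub> q = \<theta> q k)"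

definition twin_FC_subfactor ::
    "('a, 'm) monoid_scheme \<Rightarrow> 'a set \<Rightarrow> 'a set \<Rightarrow> ('a \<Rightarrow> 'a \<Rightarrow> 'a) \<Rightarrow> 'a set \<Rightarrow> 'a set \<Rightarrow> bool" where
  "twin_FC_subfactor G K Q \<theta> C C' \<longleftrightarrow>
     (subgroup C (sub G K) \<and> C \<inter> FC (sub G K) = {\<one>\<^bsub>G\<^esub>}) \<and>
     ((\<forall>q \<in> Q. \<theta> q ` C \<subseteq> C) \<and> (\<forall>c \<in> C. finite (orbit (sub G Q) \<theta> c))) \<and>
     (C' \<lhd> sub G Q \<and> C' \<subseteq> FC (sub G Q)) \<and>
     (inj_on (conj_action G K) C \<and> inj_on \<theta> C' \<and> conj_action G K ` C = \<theta> ` C') \<and>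
     (C \<noteq> {\<one>\<^bsub>G\<^esub>} \<and> (finite C \<or> (\<exists>n. sub G C \<cong> int_power n)))"

text \<open>Consistency check: conjugation provides the homomorphism \<open>\<theta>\<close> required of a split
  extension, so every internal semidirect product is one.\<close>

lemma conj_action_hom:
  fixes G (structure)
  assumes "K \<lhd> G"
  shows "conj_action G K \<in> hom G (Aut (sub G K))"
proof -
  interpret normal K G by (rule assms)
  have mem: "inv g \<otimes> k \<otimes> g \<in> K" if "g \<in> carrier G" "k \<in> K" for g k
    using inv_op_closed1[of g k] that by simp
  have "conj_action G K g \<in> auto (sub G K)" if g: "g \<in> carrier G" for g
  proof -
    have "bij_betw (conj_action G K g) K K"
    proof (rule bij_betw_byWitness[where f' = "conj_action G K (inv g)"])
      have conj_conj: "h \<otimes> (inv h \<otimes> k \<otimes> h) \<otimes> inv h = k"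
        if "h \<in> carrier G" "k \<in> K" for h k
      proof -
        have "h \<otimes> (inv h \<otimes> k) = k"
          using that mem_carrier by (simp flip: m_assoc)
        then show ?thesis using that mem_carrier by (simp add: m_assoc)
      qed
      show "\<forall>k\<in>K. conj_action G K (inv g) (conj_action G K g k) = k"
        using g mem conj_conj by (simp add: conj_action_def)
      show "\<forall>k\<in>K. conj_action G K g (conj_action G K (inv g) k) = k"
        using g mem[of "inv g"] conj_conj[of "inv g"] by (simp add: conj_action_def)
    qed (use g mem mem[of "inv g"] in \<open>auto simp: conj_action_def\<close>)
    moreover have "inv g \<otimes> (x \<otimes> y) \<otimes> g = inv g \<otimes> x \<otimes> g \<otimes> (inv g \<otimes> y \<otimes> g)"
      if "x \<in> K" "y \<in> K" for x y
    proof -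
      have "g \<otimes> (inv g \<otimes> (y \<otimes> g)) = y \<otimes> g"
        using g that mem_carrier by (simp flip: m_assoc)
      then show ?thesis using g that mem_carrier by (simp add: m_assoc)
    qed
    ultimately show ?thesis
      using g mem by (auto simp: auto_def Bij_def hom_def conj_action_def)
  qed
  moreover have "conj_action G K (g \<otimes> h) = compose K (conj_action G K h) (conj_action G K g)"
    if "g \<in> carrier G" "h \<in> carrier G" for g h
    using that mem mem_carrier
    by (auto simp: conj_action_def compose_def restrict_def fun_eq_iff inv_mult_group m_assoc)
  ultimately show ?thesis by (auto simp: hom_def Aut_def)
qed

lemma split_extension_conj_action:
  assumes "K \<lhd> G" "subgroup Q G" "K \<inter> Q = {\<one>\<^bsub>G\<^esub>}" "K <#>\<^bsub>G\<^esub> Q = carrier G"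
  shows "split_extension G K Q (conj_action G K)"
proof -
  have "conj_action G K \<in> hom (sub G Q) (Aut (sub G K))"
    using conj_action_hom[OF assms(1)] subgroup.subset[OF assms(2)]
    unfolding hom_def by auto
  then show ?thesis
    using assms by (auto simp: split_extension_def conj_action_def normal_def)
qed

end

theory Submission
  imports Defs
begin

text \<open>
  A non-trivial \<open>G\<close> fails to be icc exactly when \<open>FC G\<close> contains some \<open>x \<noteq> \<one>\<close>, so everything is about
  locating such an element with respect to the decomposition of \<open>G\<close> into \<open>K\<close> and \<open>Q\<close>.

  Each of the three conditions produces one. In (i) every element of \<open>N\<close> has a finite class. In (ii.a) two
  elements of \<open>FC Q\<close> acting alike on \<open>K\<close> have a quotient that centralizes \<open>K\<close>, so only \<open>Q\<close> moves it.
  In (ii.b) an element \<open>c \<noteq> \<one>\<close> of \<open>C\<close> and its twin \<open>q\<close> in \<open>C'\<close> act alike on \<open>K\<close>, so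
  \<open>c q\<^sup>-\<^sup>1\<close> centralizes \<open>K\<close> and again only \<open>Q\<close> moves it. Both (ii) cases are instances of
  \<open>FC_iff_of_centralizer\<close>.

  Conversely, a non-trivial element \<open>x\<close> of \<open>FC G\<close> lying in a normal subgroup \<open>M\<close> can be traded for a non-trivial
  normal subgroup \<open>N\<close> of \<open>G\<close> inside \<open>FC G \<inter> M\<close> that is finite or isomorphic to \<open>\<int>\<^sup>n\<close>
  (\<open>FC_element_normal_subgroup\<close>). The normal closure \<open>H\<close> of \<open>x\<close> is generated by the finite class of \<open>x\<close>
  and acts on it by permutations; the kernel of this action is the centre of \<open>H\<close>. If the centre is
  trivial, \<open>H\<close> is finite. Otherwise the normal closure of a central element is finitely generated abelian;
  it is \<open>\<int>\<^sup>n\<close> if torsion-free, and otherwise the normal closure of a torsion element is finite.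

  If \<open>FC G\<close> meets \<open>K\<close> non-trivially, taking \<open>M = K\<close> gives (i). If not, \<open>N\<close> and \<open>K\<close> are normal with trivial
  intersection and hence commute. Writing \<open>x = c q\<^sup>-\<^sup>1\<close> for \<open>x \<in> N\<close>, the elements \<open>c\<close> and \<open>q\<close> act alike
  on \<open>K\<close>; when (ii.a) fails, \<open>\<theta>\<close> is injective on \<open>FC Q\<close>, so \<open>c\<close> determines \<open>q\<close>, and the two
  projections of \<open>N\<close> are the sides of a twin \<open>FC\<close>-subfactor (\<open>twin_of_normal\<close>).
\<close>

section \<open>Finitely generated abelian groups\<close>

lemma finite_set_tuple:
  assumes "finite S"
  obtains x where "x ` {..<card S} = S"
  using ex_bij_betw_nat_finite[OF assms] bij_betw_imp_surj_on
  by (metis lessThan_atLeast0)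

context comm_group
begin

definition power_product :: "nat \<Rightarrow> (nat \<Rightarrow> 'a) \<Rightarrow> (nat \<Rightarrow> int) \<Rightarrow> 'a" where
  "power_product n x a = (\<Otimes>i\<in>{..<n}. x i [^] a i)"

lemma power_product_closed [simp]:
  "x \<in> {..<n} \<rightarrow> carrier G \<Longrightarrow> power_product n x a \<in> carrier G"
  by (auto simp: power_product_def intro!: finprod_closed)

lemma power_product_cong:
  assumes "x \<in> {..<n} \<rightarrow> carrier G" "\<And>i. i < n \<Longrightarrow> x i [^] a i = x i [^] b i"
  shows "power_product n x a = power_product n x b"
  unfolding power_product_def using assms by (intro finprod_cong') auto

lemma power_product_add:
  assumes "x \<in> {..<n} \<rightarrow> carrier G"
  shows "power_product n x (\<lambda>i. a i + b i) = power_product n x a \<otimes> power_product n x b"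
proof -
  have "power_product n x (\<lambda>i. a i + b i) = (\<Otimes>i\<in>{..<n}. x i [^] a i \<otimes> x i [^] b i)"
    unfolding power_product_def using assms
    by (intro finprod_cong') (auto simp: int_pow_mult Pi_iff)
  also have "\<dots> = power_product n x a \<otimes> power_product n x b"
    unfolding power_product_def using assms by (intro finprod_multf) auto
  finally show ?thesis .
qed

lemma power_product_single:
  assumes "x \<in> {..<n} \<rightarrow> carrier G" "i < n"
  shows "power_product n x (\<lambda>j. if j = i then k else 0) = x i [^] k"
proof -
  have "power_product n x (\<lambda>j. if j = i then k else 0)
      = (\<Otimes>j\<in>{..<n}. if i = j then x j [^] k else \<one>)"
    unfolding power_product_def using assms by (intro finprod_cong') (auto simp: Pi_iff)
  also have "\<dots> = x i [^] k"
    using assms finprod_singleton[of i "{..<n}" "\<lambda>j. x j [^] k"] by (simp add: Pi_iff)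
  finally show ?thesis .
qed

lemma generate_eq_power_products:
  assumes x: "x \<in> {..<n} \<rightarrow> carrier G"
  shows "generate G (x ` {..<n}) = range (power_product n x)"
proof
  have xc: "x ` {..<n} \<subseteq> carrier G" using x by auto
  show "generate G (x ` {..<n}) \<subseteq> range (power_product n x)"
  proof
    fix g assume "g \<in> generate G (x ` {..<n})"
    then show "g \<in> range (power_product n x)"
    proof induction
      case one
      have "power_product n x (\<lambda>_. 0) = \<one>" by (simp add: power_product_def)
      then show ?case by (metis rangeI)
    next
      case (incl h)
      then obtain i where "i < n" "h = x i" by auto
      then have "power_product n x (\<lambda>j. if j = i then 1 else 0) = h"
        using power_product_single[OF x, of i 1] x by (simp add: Pi_iff int_pow_1)
      then show ?case by (metis rangeI)
    next
      case (inv h)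
      then obtain i where "i < n" "h = x i" by auto
      then have "power_product n x (\<lambda>j. if j = i then - 1 else 0) = inv h"
        using power_product_single[OF x, of i "- 1"] x by (simp add: Pi_iff int_pow_neg)
      then show ?case by (metis rangeI)
    next
      case (eng g h)
      then obtain a b where "g = power_product n x a" "h = power_product n x b" by auto
      then have "g \<otimes> h = power_product n x (\<lambda>i. a i + b i)"
        using power_product_add[OF x] by simp
      then show ?case by simp
    qed
  qed
  have sg: "subgroup (generate G (x ` {..<n})) G"
    by (rule generate_is_subgroup[OF xc])
  have "power_product m x a \<in> generate G (x ` {..<n})" if "m \<le> n" for m a
    using that
  proof (induction m)
    case 0 then show ?case by (simp add: power_product_def generate.one)
  next
    case (Suc m)
    have "x m [^] a m \<in> generate G (x ` {..<n})"
      using Suc.prems by (intro subgroup_int_pow_closed[OF sg] generate.incl) auto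
    moreover have "power_product (Suc m) x a = x m [^] a m \<otimes> power_product m x a"
      using x Suc.prems by (simp add: power_product_def lessThan_Suc Pi_iff)
    ultimately show ?case using Suc by (simp add: generate.eng)
  qed
  then show "range (power_product n x) \<subseteq> generate G (x ` {..<n})" by auto
qed

text \<open>
  Only exponents modulo \<open>m\<close> matter in a product of powers of the generators, so there are finitely many
  such products.
\<close>
lemma finite_generate_of_exponent:
  assumes "finite S" "S \<subseteq> carrier G" "m > 0" "\<And>s. s \<in> S \<Longrightarrow> s [^] (m :: int) = \<one>"
  shows "finite (generate G S)"
proof -
  obtain x where x: "x ` {..<card S} = S" using finite_set_tuple[OF assms(1)] .
  define n where "n = card S"
  have xc: "x \<in> {..<n} \<rightarrow> carrier G" using x assms(2) n_def by auto
  have "power_product n x a \<in> power_product n x ` ({..<n} \<rightarrow>\<^sub>E {0..<m})" for a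
  proof
    show "power_product n x a = power_product n x (\<lambda>i\<in>{..<n}. a i mod m)"
    proof (rule power_product_cong[OF xc])
      fix i assume i: "i < n"
      then have xi: "x i \<in> carrier G" "x i [^] m = \<one>" using x assms(2,4) n_def by auto
      have "x i [^] a i = x i [^] (m * (a i div m)) \<otimes> x i [^] (a i mod m)"
        using xi by (simp flip: int_pow_mult)
      also have "\<dots> = x i [^] (a i mod m)"
        using xi int_pow_pow[of "x i" m "a i div m"] by (simp add: int_pow_one)
      finally show "x i [^] a i = x i [^] (\<lambda>i\<in>{..<n}. a i mod m) i" using i by simp
    qed
    show "(\<lambda>i\<in>{..<n}. a i mod m) \<in> {..<n} \<rightarrow>\<^sub>E {0..<m}" using assms(3) by auto
  qed
  then have "generate G S \<subseteq> power_product n x ` ({..<n} \<rightarrow>\<^sub>E {0..<m})"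
    using generate_eq_power_products[OF xc] x n_def by auto
  moreover have "finite ({..<n} \<rightarrow>\<^sub>E {0..<m})" by (intro finite_PiE) auto
  ultimately show ?thesis by (meson finite_imageI finite_subset)
qed

text \<open>
  The elementary move on generators: a tuple \<open>x\<close> may be replaced by one with \<open>x\<^sub>j x\<^sub>i\<^sup>e\<close> in place of \<open>x\<^sub>j\<close>, since
  the extra factor \<open>x\<^sub>i\<close> to the power \<open>e a\<^sub>j\<close> is absorbed in the exponent of \<open>x\<^sub>i\<close>. Together with
  \<open>generate_transvection\<close> it lowers one coefficient of a relation as in the Euclidean algorithm.
\<close>
lemma power_product_transvection:
  assumes x: "x \<in> {..<n} \<rightarrow> carrier G" and ij: "i < n" "j < n" "i \<noteq> j"
  shows "power_product n (x(j := x j \<otimes> x i [^] e)) (a(i := a i - e * a j)) = power_product n x a"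
proof -
  define J where "J = {..<n} - {i, j}"
  have split: "{..<n} = insert i (insert j J)" using ij J_def by auto
  have J: "finite J" "i \<notin> insert j J" "j \<notin> J" using ij J_def by auto
  define r where "r = (\<Otimes>k\<in>J. x k [^] a k)"
  have c: "x i \<in> carrier G" "x j \<in> carrier G" "r \<in> carrier G" "x \<in> J \<rightarrow> carrier G"
    using x ij by (auto simp: r_def J_def intro!: finprod_closed)
  have "power_product n x a = x i [^] a i \<otimes> (x j [^] a j \<otimes> r)"
    unfolding power_product_def split using J c r_def by (simp add: Pi_iff)
  moreover have "power_product n (x(j := x j \<otimes> x i [^] e)) (a(i := a i - e * a j))
      = x i [^] (a i - e * a j) \<otimes> ((x j \<otimes> x i [^] e) [^] a j \<otimes> r)"
  proof -
    have "r = (\<Otimes>k\<in>J. (x(j := x j \<otimes> x i [^] e)) k [^] (a(i := a i - e * a j)) k)"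
      unfolding r_def using J c by (intro finprod_cong') (auto simp: Pi_iff)
    then show ?thesis
      unfolding power_product_def split using J c ij by (simp add: Pi_iff)
  qed
  moreover have "x i [^] a i = x i [^] (a i - e * a j) \<otimes> x i [^] (e * a j)"
    using c by (simp flip: int_pow_mult)
  moreover have "(x j \<otimes> x i [^] e) [^] a j = x j [^] a j \<otimes> x i [^] (e * a j)"
    using c by (simp add: int_pow_distrib int_pow_pow)
  ultimately show ?thesis using c by (simp add: m_ac)
qed

lemma generate_transvection:
  assumes x: "x \<in> {..<n} \<rightarrow> carrier G" and ij: "i < n" "j < n" "i \<noteq> j"
  shows "generate G (x ` {..<n}) \<subseteq> generate G (x(j := x j \<otimes> x i [^] (e::int)) ` {..<n})"
proof -
  define y where "y = x(j := x j \<otimes> x i [^] e)"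
  have c: "x i \<in> carrier G" "x j \<in> carrier G" using x ij by auto
  have yc: "y ` {..<n} \<subseteq> carrier G" using x ij c by (auto simp: y_def)
  have sg: "subgroup (generate G (y ` {..<n})) G" by (rule generate_is_subgroup[OF yc])
  have y: "y k \<in> generate G (y ` {..<n})" if "k < n" for k
    using that by (intro generate.incl) auto
  have "x j = y j \<otimes> inv (y i [^] e)" using c ij by (simp add: y_def m_assoc)
  also have "\<dots> \<in> generate G (y ` {..<n})"
    using y ij by (intro subgroup.m_closed[OF sg] subgroup.m_inv_closed[OF sg]
        subgroup_int_pow_closed[OF sg]) auto
  finally have "x k \<in> generate G (y ` {..<n})" if "k < n" for k
    using y[OF that] by (cases "k = j") (auto simp: y_def)
  then have "generate G (x ` {..<n}) \<subseteq> generate G (y ` {..<n})"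
    by (intro generate_subgroup_incl[OF _ sg]) auto
  then show ?thesis by (simp add: y_def)
qed

text \<open>
  Descent on the sum of the absolute values of the coefficients of a relation. If two coefficients are
  non-zero, a transvection makes the larger one smaller and keeps both the group generated and the length of
  the tuple. A relation with a single non-zero coefficient says that a generator has finite order, so that
  generator is trivial and can be dropped, against the minimality of \<open>n\<close>.
\<close>
lemma no_relation_of_minimal_generators:
  assumes tf: "\<And>g m. \<lbrakk>g \<in> carrier G; g [^] (m :: int) = \<one>; m \<noteq> 0\<rbrakk> \<Longrightarrow> g = \<one>"
    and min: "\<And>S. \<lbrakk>finite S; S \<subseteq> carrier G; generate G S = carrier G\<rbrakk> \<Longrightarrow> n \<le> card S"
    and "x \<in> {..<n} \<rightarrow> carrier G" "generate G (x ` {..<n}) = carrier G"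
    and "power_product n x a = \<one>" "i < n"
  shows "a i = 0"
  using assms(3-)
proof (induction "\<Sum>k<n. nat \<bar>a k\<bar>" arbitrary: a x i rule: less_induct)
  case less
  show ?case
  proof (rule ccontr)
    assume ai: "a i \<noteq> 0"
    show False
    proof (cases "\<exists>j. j < n \<and> j \<noteq> i \<and> a j \<noteq> 0")
      case False
      have "\<one> = power_product n x (\<lambda>j. if j = i then a i else 0)"
        unfolding less.prems(3)[symmetric]
        by (rule power_product_cong[OF less.prems(1)]) (use False in auto)
      then have "x i [^] a i = \<one>"
        using power_product_single[OF less.prems(1,4)] by simp
      then have xi: "x i = \<one>" using tf[OF _ _ ai] less.prems(1,4) by auto
      let ?S = "x ` ({..<n} - {i})"
      have S: "?S \<subseteq> carrier G" using less.prems(1) by auto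
      have "x k \<in> generate G ?S" if "k < n" for k
        using xi that by (cases "k = i") (auto intro: generate.one generate.incl)
      then have "generate G (x ` {..<n}) \<subseteq> generate G ?S"
        by (intro generate_subgroup_incl generate_is_subgroup S) auto
      then have "generate G ?S = carrier G"
        using less.prems(2) generate_incl[OF S] by auto
      then have "n \<le> card ?S" using S by (intro min) auto
      also have "\<dots> \<le> card ({..<n} - {i})" by (intro card_image_le) auto
      also have "\<dots> < n" using less.prems(4) by simp
      finally show False by simp
    next
      case True
      have *: False if pq: "p < n" "q < n" "p \<noteq> q" "a q \<noteq> 0" "\<bar>a q\<bar> \<le> \<bar>a p\<bar>" for p q
      proof -
        \<comment> \<open>With this sign the new coefficient has absolute value \<open>\<bar>a p\<bar> - \<bar>a q\<bar>\<close>.\<close>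
        define e where "e = sgn (a p) * sgn (a q)"
        define y where "y = x(q := x q \<otimes> x p [^] e)"
        define b where "b = a(p := a p - e * a q)"
        have "nat \<bar>a p - e * a q\<bar> < nat \<bar>a p\<bar>"
          using pq(4,5) by (auto simp: e_def sgn_if split: if_splits)
        then have "(\<Sum>k<n. nat \<bar>b k\<bar>) < (\<Sum>k<n. nat \<bar>a k\<bar>)"
          using pq(1) by (intro sum_strict_mono_ex1) (auto simp: b_def intro!: bexI[of _ p])
        moreover have y: "y \<in> {..<n} \<rightarrow> carrier G" using less.prems(1) pq by (auto simp: y_def Pi_iff)
        moreover have "generate G (y ` {..<n}) = carrier G"
          using generate_transvection[OF less.prems(1) pq(1-3), of e] less.prems(2) generate_incl[of "y ` {..<n}"] y
          unfolding y_def[symmetric] by blast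
        moreover have "power_product n y b = \<one>"
          using power_product_transvection[OF less.prems(1) pq(1-3)] less.prems(3)
          by (simp add: y_def b_def)
        \<comment> \<open>The coefficient at \<open>q\<close> is unchanged, so the smaller relation is still non-trivial.\<close>
        ultimately have "b q = 0" using less.hyps[of b y q] pq(2) by blast
        then show False using pq(3,4) by (simp add: b_def)
      qed
      obtain j where "j < n" "j \<noteq> i" "a j \<noteq> 0" using True by blast
      then show False
        using *[of i j] *[of j i] ai less.prems(4) by linarith
    qed
  qed
qed

text \<open>
  A generating set of least cardinality satisfies no relation, so it is a basis.
\<close>
lemma torsion_free_fg_iso_int_power:
  assumes tf: "\<And>g m. \<lbrakk>g \<in> carrier G; g [^] (m :: int) = \<one>; m \<noteq> 0\<rbrakk> \<Longrightarrow> g = \<one>"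
    and fg: "finite S" "S \<subseteq> carrier G" "generate G S = carrier G"
  shows "\<exists>n. G \<cong> int_power n"
proof -
  define P where "P n \<longleftrightarrow> (\<exists>S. finite S \<and> S \<subseteq> carrier G \<and> generate G S = carrier G \<and> card S = n)" for n
  have "P (card S)" using fg P_def by blast
  define n where "n = (LEAST n. P n)"
  have "P n" unfolding n_def by (rule LeastI) fact
  then obtain T where T: "finite T" "T \<subseteq> carrier G" "generate G T = carrier G" "card T = n"
    using P_def by auto
  have min: "n \<le> card S" if "finite S" "S \<subseteq> carrier G" "generate G S = carrier G" for S
    unfolding n_def by (rule Least_le) (use that P_def in blast)
  obtain x where xT: "x ` {..<n} = T" using finite_set_tuple[OF T(1)] T(4) by blast
  have x: "x \<in> {..<n} \<rightarrow> carrier G" using xT T(2) by auto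
  have gen: "generate G (x ` {..<n}) = carrier G" using xT T(3) by simp
  have "power_product n x \<in> iso (int_power n) G"
  proof (rule isoI)
    show "power_product n x \<in> hom (int_power n) G"
    proof (rule homI)
      fix a b
      have "power_product n x (\<lambda>i\<in>{..<n}. a i + b i) = power_product n x (\<lambda>i. a i + b i)"
        by (rule power_product_cong[OF x]) simp
      then show "power_product n x (a \<otimes>\<^bsub>int_power n\<^esub> b) = power_product n x a \<otimes> power_product n x b"
        using power_product_add[OF x] by (simp add: int_power_def)
    qed (use x in simp)
    show "bij_betw (power_product n x) (carrier (int_power n)) (carrier G)"
      unfolding bij_betw_def
    proof
      show "inj_on (power_product n x) (carrier (int_power n))"
      proof (rule inj_onI)
        fix a b assume ab: "a \<in> carrier (int_power n)" "b \<in> carrier (int_power n)"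
          and eq: "power_product n x a = power_product n x b"
        have "power_product n x a = power_product n x (\<lambda>i. a i - b i) \<otimes> power_product n x b"
          using power_product_add[OF x, of "\<lambda>i. a i - b i" b] by (simp only: diff_add_cancel)
        then have "power_product n x (\<lambda>i. a i - b i) = \<one>"
          using eq x by (metis power_product_closed r_cancel_one)
        note rel = this
        have "a i - b i = 0" if i: "i < n" for i
          by (rule no_relation_of_minimal_generators[where n = n and x = x
                and a = "\<lambda>i. a i - b i", OF _ _ x gen rel i]) (fact tf, fact min)
        then have "a i = b i" if "i < n" for i using that by simp
        then show "a = b" using ab unfolding int_power_def by (auto intro: PiE_ext)
      qed
      show "power_product n x ` carrier (int_power n) = carrier G"
      proof -
        have "power_product n x a = power_product n x (\<lambda>i\<in>{..<n}. a i)" for a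
          by (rule power_product_cong[OF x]) simp
        moreover have "(\<lambda>i\<in>{..<n}. a i) \<in> carrier (int_power n)" for a :: "nat \<Rightarrow> int"
          by (auto simp: int_power_def)
        ultimately have "range (power_product n x) \<subseteq> power_product n x ` carrier (int_power n)"
          by blast
        then show ?thesis using generate_eq_power_products[OF x] gen x by auto
      qed
    qed
  qed
  moreover have "group (int_power n)" by (simp add: int_power_def)
  ultimately show ?thesis using group.iso_sym is_isoI by blast
qed

end

section \<open>Conjugation and the FC-centre\<close>

context group
begin

text \<open>
  The right action of \<open>G\<close> on itself, in the convention of \<open>conj_action\<close> but on all elements, so that no
  restriction to a normal subgroup has to be carried along.
\<close>
definition conj_by :: "'a \<Rightarrow> 'a \<Rightarrow> 'a" where
  "conj_by g x = inv g \<otimes> x \<otimes> g"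

definition centralizer :: "'a set \<Rightarrow> 'a set" where
  "centralizer S = {g \<in> carrier G. \<forall>s \<in> S. g \<otimes> s = s \<otimes> g}"

lemma conj_by_closed [simp]:
  "\<lbrakk>g \<in> carrier G; x \<in> carrier G\<rbrakk> \<Longrightarrow> conj_by g x \<in> carrier G"
  by (simp add: conj_by_def)

lemma mult_inv_cancel_left:
  assumes "g \<in> carrier G" "x \<in> carrier G"
  shows "g \<otimes> (inv g \<otimes> x) = x" "inv g \<otimes> (g \<otimes> x) = x"
  using assms by (simp_all flip: m_assoc)

lemma conj_by_mult:
  "\<lbrakk>g \<in> carrier G; x \<in> carrier G; y \<in> carrier G\<rbrakk> \<Longrightarrow> conj_by g (x \<otimes> y) = conj_by g x \<otimes> conj_by g y"
  by (simp add: conj_by_def m_assoc mult_inv_cancel_left)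

lemma conj_by_inv:
  "\<lbrakk>g \<in> carrier G; x \<in> carrier G\<rbrakk> \<Longrightarrow> conj_by g (inv x) = inv (conj_by g x)"
  by (simp add: conj_by_def m_assoc inv_mult_group)

lemma conj_by_conj_by:
  "\<lbrakk>g \<in> carrier G; h \<in> carrier G; x \<in> carrier G\<rbrakk> \<Longrightarrow> conj_by h (conj_by g x) = conj_by (g \<otimes> h) x"
  by (simp add: conj_by_def m_assoc inv_mult_group)

lemma conj_by_one [simp]: "g \<in> carrier G \<Longrightarrow> conj_by g \<one> = \<one>"
  by (simp add: conj_by_def)

lemma one_conj_by [simp]: "x \<in> carrier G \<Longrightarrow> conj_by \<one> x = x"
  by (simp add: conj_by_def)

lemma conj_by_inv_cancel:
  "\<lbrakk>g \<in> carrier G; x \<in> carrier G\<rbrakk> \<Longrightarrow> conj_by g (conj_by (inv g) x) = x"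
  by (simp add: conj_by_conj_by)

lemma conj_by_inj:
  "\<lbrakk>g \<in> carrier G; x \<in> carrier G; y \<in> carrier G; conj_by g x = conj_by g y\<rbrakk> \<Longrightarrow> x = y"
  by (simp add: conj_by_def)

lemma conj_by_eq_iff_commute:
  "\<lbrakk>g \<in> carrier G; x \<in> carrier G\<rbrakk> \<Longrightarrow> conj_by g x = x \<longleftrightarrow> g \<otimes> x = x \<otimes> g"
  by (metis conj_by_def inv_closed inv_solve_left m_assoc m_closed)

lemma conj_by_pow:
  "\<lbrakk>g \<in> carrier G; x \<in> carrier G\<rbrakk> \<Longrightarrow> conj_by g (x [^] (n::nat)) = conj_by g x [^] n"
  by (induction n) (simp_all add: conj_by_mult)

lemma conj_by_int_pow:
  "\<lbrakk>g \<in> carrier G; x \<in> carrier G\<rbrakk> \<Longrightarrow> conj_by g (x [^] (n::int)) = conj_by g x [^] n"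
  by (cases n rule: int_cases2) (simp_all add: int_pow_int int_pow_neg_int conj_by_pow conj_by_inv)

lemma conj_class_eq: "conj_class G x = (\<lambda>g. conj_by g x) ` carrier G"
  by (auto simp: conj_class_def conj_by_def)

lemma conj_class_closed: "x \<in> carrier G \<Longrightarrow> conj_class G x \<subseteq> carrier G"
  by (auto simp: conj_class_eq)

lemma mem_conj_class_self: "x \<in> carrier G \<Longrightarrow> x \<in> conj_class G x"
  by (auto simp: conj_class_eq image_iff intro!: bexI[of _ \<one>])

lemma conj_by_mem_conj_class:
  "\<lbrakk>x \<in> carrier G; g \<in> carrier G; y \<in> conj_class G x\<rbrakk> \<Longrightarrow> conj_by g y \<in> conj_class G x"
  by (auto simp: conj_class_eq conj_by_conj_by)

lemma normal_iff_conj_by: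
  "N \<lhd> G \<longleftrightarrow> subgroup N G \<and> (\<forall>g \<in> carrier G. \<forall>x \<in> N. conj_by g x \<in> N)"
  unfolding normal_inv_iff conj_by_def by (metis inv_closed inv_inv)

lemma normal_generate_conj_class:
  assumes "x \<in> carrier G"
  shows "generate G (conj_class G x) \<lhd> G"
proof (rule normal_generateI[OF conj_class_closed[OF assms]])
  fix h g assume "h \<in> conj_class G x" "g \<in> carrier G"
  then have "conj_by (inv g) h \<in> conj_class G x"
    using assms by (intro conj_by_mem_conj_class) auto
  then show "g \<otimes> h \<otimes> inv g \<in> conj_class G x"
    using \<open>g \<in> carrier G\<close> by (simp add: conj_by_def)
qed

lemma FC_normal: "FC G \<lhd> G"
proof -
  have "conj_class G (conj_by g x) \<subseteq> conj_class G x" if "g \<in> carrier G" "x \<in> carrier G" for g x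
    using that by (auto simp: conj_class_eq conj_by_conj_by)
  then have conj: "conj_by g x \<in> FC G" if "g \<in> carrier G" "x \<in> FC G" for g x
    using that unfolding FC_def by (auto intro: finite_subset)
  have "conj_class G (x \<otimes> y) \<subseteq> (\<lambda>(u, v). u \<otimes> v) ` (conj_class G x \<times> conj_class G y)"
    if "x \<in> carrier G" "y \<in> carrier G" for x y
    using that by (auto simp: conj_class_eq conj_by_mult)
  then have mult: "x \<otimes> y \<in> FC G" if "x \<in> FC G" "y \<in> FC G" for x y
    using that finite_subset[of "conj_class G (x \<otimes> y)"
        "(\<lambda>(u, v). u \<otimes> v) ` (conj_class G x \<times> conj_class G y)"]
    by (simp add: FC_def)
  have "conj_class G (inv x) \<subseteq> m_inv G ` conj_class G x"
    if "x \<in> carrier G" for x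
    using that by (auto simp: conj_class_eq conj_by_inv)
  then have inv: "inv x \<in> FC G" if "x \<in> FC G" for x
    using that finite_subset[of "conj_class G (inv x)" "m_inv G ` conj_class G x"]
    by (simp add: FC_def)
  have "conj_class G \<one> = {\<one>}" by (auto simp: conj_class_eq)
  then have "subgroup (FC G) G"
    using mult inv by (intro subgroup.intro) (auto simp: FC_def)
  then show ?thesis using conj by (simp add: normal_iff_conj_by)
qed

lemma subgroup_centralizer:
  assumes "S \<subseteq> carrier G"
  shows "subgroup (centralizer S) G"
proof (rule subgroup.intro)
  fix x y assume xy: "x \<in> centralizer S" "y \<in> centralizer S"
  have "x \<otimes> y \<otimes> s = s \<otimes> (x \<otimes> y)" if "s \<in> S" for s
  proof -
    have c: "s \<in> carrier G" "x \<in> carrier G" "y \<in> carrier G" "x \<otimes> s = s \<otimes> x" "y \<otimes> s = s \<otimes> y"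
      using that assms xy by (auto simp: centralizer_def)
    then have "x \<otimes> y \<otimes> s = x \<otimes> (s \<otimes> y)" by (simp only: m_assoc)
    also have "\<dots> = s \<otimes> (x \<otimes> y)" using c by (simp flip: m_assoc)
    finally show ?thesis .
  qed
  then show "x \<otimes> y \<in> centralizer S" using xy by (auto simp: centralizer_def)
next
  fix x assume x: "x \<in> centralizer S"
  have "inv x \<otimes> s = s \<otimes> inv x" if "s \<in> S" for s
  proof -
    have c: "s \<in> carrier G" "x \<in> carrier G" "s \<otimes> x = x \<otimes> s"
      using that assms x by (auto simp: centralizer_def)
    then have "conj_by s x = x" by (simp add: conj_by_eq_iff_commute)
    then have "conj_by s (inv x) = inv x" using c by (simp add: conj_by_inv)
    then show ?thesis using c by (simp add: conj_by_eq_iff_commute)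
  qed
  then show "inv x \<in> centralizer S" using x by (auto simp: centralizer_def)
qed (use assms in \<open>auto simp: centralizer_def\<close>)

lemma centralizer_generate:
  assumes "S \<subseteq> carrier G" "a \<in> centralizer S"
  shows "a \<in> centralizer (generate G S)"
proof -
  have a: "a \<in> carrier G" using assms by (simp add: centralizer_def)
  have "generate G S \<subseteq> centralizer {a}"
    using assms a by (intro generate_subgroup_incl subgroup_centralizer) (auto simp: centralizer_def)
  then show ?thesis using a by (auto simp: centralizer_def)
qed

text \<open>
  A generator commutes with the other generators, hence with everything they generate; thus the generators
  lie in the centralizer of the generated subgroup, and so does that subgroup itself.
\<close>
lemma comm_group_generate:
  assumes "S \<subseteq> carrier G" "\<And>s t. \<lbrakk>s \<in> S; t \<in> S\<rbrakk> \<Longrightarrow> s \<otimes> t = t \<otimes> s"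
  shows "comm_group (sub G (generate G S))"
proof -
  have "S \<subseteq> centralizer (generate G S)"
  proof
    fix s assume "s \<in> S"
    then have "s \<in> centralizer S" using assms by (auto simp: centralizer_def)
    then show "s \<in> centralizer (generate G S)" by (rule centralizer_generate[OF assms(1)])
  qed
  then have "generate G S \<subseteq> centralizer (generate G S)"
    using assms by (intro generate_subgroup_incl subgroup_centralizer generate_incl)
  moreover have "group (sub G (generate G S))"
    using assms by (intro subgroup_imp_group generate_is_subgroup)
  ultimately show ?thesis
    by (intro group.group_comm_groupI) (auto simp: centralizer_def)
qed

text \<open>
  The generated subgroup acts by conjugation on the finite set \<open>S\<close> of its generators. Two elements with
  the same action differ by an element that centralizes \<open>S\<close> and is therefore central; so a trivial
  centre embeds the subgroup in the finite set of maps from \<open>S\<close> to \<open>S\<close>.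
\<close>
lemma finite_generate_of_trivial_center:
  assumes S: "finite S" "S \<subseteq> carrier G"
    and stable: "\<And>g s. \<lbrakk>g \<in> carrier G; s \<in> S\<rbrakk> \<Longrightarrow> conj_by g s \<in> S"
    and triv: "generate G S \<inter> centralizer S \<subseteq> {\<one>}"
  shows "finite (generate G S)"
proof -
  let ?N = "generate G S"
  let ?f = "\<lambda>g. \<lambda>s\<in>S. conj_by g s"
  have N: "subgroup ?N G" using S by (intro generate_is_subgroup)
  then have Nc: "?N \<subseteq> carrier G" by (rule subgroup.subset)
  have "inj_on ?f ?N"
  proof (rule inj_onI)
    fix g h assume gh: "g \<in> ?N" "h \<in> ?N" "?f g = ?f h"
    have c: "g \<in> carrier G" "h \<in> carrier G" using gh Nc by auto
    have "conj_by (g \<otimes> inv h) s = s" if "s \<in> S" for s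
    proof -
      have "s \<in> carrier G" using that S by auto
      moreover have "conj_by g s = conj_by h s" using gh(3) that by (metis restrict_apply')
      ultimately show ?thesis using c conj_by_conj_by[of g "inv h" s] conj_by_conj_by[of h "inv h" s]
        by simp
    qed
    then have "g \<otimes> inv h \<in> centralizer S"
      using S c conj_by_eq_iff_commute[of "g \<otimes> inv h"] by (auto simp: centralizer_def)
    moreover have "g \<otimes> inv h \<in> ?N"
      using gh N by (simp add: subgroup.m_closed subgroup.m_inv_closed)
    ultimately have "g \<otimes> inv h = \<one>" using triv by auto
    then show "g = h" using c by (metis inv_closed inv_equality inv_inv)
  qed
  moreover have "?f ` ?N \<subseteq> S \<rightarrow>\<^sub>E S" using stable Nc by auto
  moreover have "finite (S \<rightarrow>\<^sub>E S)" using S by (intro finite_PiE) auto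
  ultimately show ?thesis by (meson finite_imageD finite_subset)
qed

lemma normal_closure_of_element:
  assumes "x \<in> M" "M \<lhd> G"
  shows "generate G (conj_class G x) \<lhd> G" "generate G (conj_class G x) \<subseteq> M"
    "x \<in> generate G (conj_class G x)"
proof -
  have M: "subgroup M G" "\<And>g y. \<lbrakk>g \<in> carrier G; y \<in> M\<rbrakk> \<Longrightarrow> conj_by g y \<in> M"
    using assms(2) normal_iff_conj_by by auto
  then have x: "x \<in> carrier G" using assms(1) subgroup.mem_carrier by fastforce
  show "generate G (conj_class G x) \<lhd> G" by (rule normal_generate_conj_class[OF x])
  show "generate G (conj_class G x) \<subseteq> M"
    using M assms(1) by (intro generate_subgroup_incl) (auto simp: conj_class_eq)
  show "x \<in> generate G (conj_class G x)" by (intro generate.incl mem_conj_class_self x)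
qed

text \<open>
  The normal closure of an element of \<open>FC G\<close> is generated by a finite class. If it is abelian and
  torsion-free, it is itself free abelian. If it has a torsion element \<open>t\<close>, the conjugates of \<open>t\<close>
  are finitely many and share an exponent with \<open>t\<close>, so the smaller normal closure of \<open>t\<close> is finite.
\<close>
lemma abelian_normal_closure:
  assumes a: "a \<in> FC G" "a \<noteq> \<one>" and comm: "comm_group (sub G (generate G (conj_class G a)))"
  shows "\<exists>N. N \<lhd> G \<and> N \<noteq> {\<one>} \<and> N \<subseteq> generate G (conj_class G a) \<and>
    (finite N \<or> (\<exists>n. sub G N \<cong> int_power n))"
proof -
  let ?S = "conj_class G a"
  define A where "A = generate G ?S"
  have ac: "a \<in> carrier G" and fin: "finite ?S" using a by (auto simp: FC_def)
  have S: "?S \<subseteq> carrier G" by (rule conj_class_closed[OF ac])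
  have normal: "A \<lhd> G" unfolding A_def by (rule normal_generate_conj_class[OF ac])
  then have A: "subgroup A G" using normal_iff_conj_by by blast
  interpret A: comm_group "sub G A" using comm A_def by simp
  have SA: "?S \<subseteq> A" by (auto simp: A_def intro: generate.incl)
  show ?thesis
  proof (cases "\<exists>t\<in>A. t \<noteq> \<one> \<and> (\<exists>m::int. m \<noteq> 0 \<and> t [^] m = \<one>)")
    case False
    have "g = \<one>\<^bsub>sub G A\<^esub>"
      if "g \<in> carrier (sub G A)" "g [^]\<^bsub>sub G A\<^esub> (m::int) = \<one>\<^bsub>sub G A\<^esub>" "m \<noteq> 0" for g m
      using that False int_pow_consistent[OF A, of g m] by auto
    then have "\<exists>n. sub G A \<cong> int_power n"
      using fin SA generate_consistent[OF SA A]
      by (intro A.torsion_free_fg_iso_int_power[of ?S]) (auto simp: A_def)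
    moreover have "A \<noteq> {\<one>}" using mem_conj_class_self[OF ac] SA a by auto
    ultimately show ?thesis using normal unfolding A_def by blast
  next
    case True
    then obtain t m where t: "t \<in> A" "t \<noteq> \<one>" "t [^] (m::int) = \<one>" "m \<noteq> 0" by blast
    have tc: "t \<in> carrier G" using t A subgroup.mem_carrier by fastforce
    let ?T = "conj_class G t"
    have "A \<subseteq> FC G"
      unfolding A_def by (rule normal_closure_of_element(2)[OF a(1) FC_normal])
    then have finT: "finite ?T" using t by (auto simp: FC_def)
    have TA: "generate G ?T \<subseteq> A" by (rule normal_closure_of_element(2)[OF t(1) normal])
    have TA': "?T \<subseteq> A" using TA by (auto intro: generate.incl)
    have pow: "s [^] \<bar>m\<bar> = \<one>" if s: "s \<in> ?T" for s
    proof -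
      obtain g where g: "g \<in> carrier G" "s = conj_by g t" using s by (auto simp: conj_class_eq)
      then have "s [^] m = \<one>" using conj_by_int_pow[OF g(1) tc, of m] t(3) by simp
      then show ?thesis using g tc by (cases "m \<ge> 0") (simp_all add: int_pow_neg abs_if)
    qed
    have "finite (generate (sub G A) ?T)"
    proof (rule A.finite_generate_of_exponent)
      fix s assume "s \<in> ?T"
      then show "s [^]\<^bsub>sub G A\<^esub> \<bar>m\<bar> = \<one>\<^bsub>sub G A\<^esub>"
        using pow int_pow_consistent[OF A, of s "\<bar>m\<bar>"] TA' by auto
    qed (use finT TA' t in auto)
    then have "finite (generate G ?T)" using generate_consistent[OF TA' A] by simp
    moreover have "generate G ?T \<noteq> {\<one>}" using normal_closure_of_element(3)[OF t(1) normal] t(2) by auto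
    ultimately show ?thesis using TA normal_closure_of_element(1)[OF t(1) normal] unfolding A_def by blast
  qed
qed

text \<open>
  The normal closure \<open>H\<close> of \<open>x\<close> is finite when its centre is trivial. Otherwise a central element \<open>z \<noteq> \<one>\<close>
  serves in place of \<open>x\<close>: the centre of \<open>H\<close> is normal in \<open>G\<close>, so the conjugates of \<open>z\<close> are
  again central in \<open>H\<close> and commute with each other.
\<close>
lemma FC_element_normal_subgroup:
  assumes x: "x \<in> FC G" "x \<noteq> \<one>" "x \<in> M" and M: "M \<lhd> G"
  shows "\<exists>N. N \<lhd> G \<and> N \<noteq> {\<one>} \<and> N \<subseteq> FC G \<inter> M \<and>
    (finite N \<or> (\<exists>n. sub G N \<cong> int_power n))"
proof -
  let ?S = "conj_class G x"
  have xc: "x \<in> carrier G" and fin: "finite ?S" using x by (auto simp: FC_def)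
  have S: "?S \<subseteq> carrier G" by (rule conj_class_closed[OF xc])
  have H: "generate G ?S \<subseteq> FC G \<inter> M" "generate G ?S \<lhd> G" "x \<in> generate G ?S"
    using normal_closure_of_element[OF x(1) FC_normal] normal_closure_of_element[OF x(3) M] by auto
  show ?thesis
  proof (cases "generate G ?S \<inter> centralizer ?S \<subseteq> {\<one>}")
    case True
    then have "finite (generate G ?S)"
      using finite_generate_of_trivial_center[OF fin S] conj_by_mem_conj_class[OF xc] by blast
    then show ?thesis using H x(2) by blast
  next
    case False
    then obtain z where z: "z \<in> generate G ?S" "z \<in> centralizer ?S" "z \<noteq> \<one>" by blast
    have zc: "z \<in> carrier G" using z by (simp add: centralizer_def)
    have incl: "generate G (conj_class G z) \<subseteq> generate G ?S"
      by (rule normal_closure_of_element(2)[OF z(1) H(2)])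
    have "conj_by g z \<in> centralizer ?S" if g: "g \<in> carrier G" for g
      unfolding centralizer_def
    proof (intro CollectI conjI ballI)
      fix s assume s: "s \<in> ?S"
      then have sc: "s \<in> carrier G" using S by auto
      have "conj_by (inv g) s \<in> ?S" using g xc s by (intro conj_by_mem_conj_class) auto
      then have "z \<otimes> conj_by (inv g) s = conj_by (inv g) s \<otimes> z"
        using z(2) by (simp add: centralizer_def)
      then have "conj_by g (z \<otimes> conj_by (inv g) s) = conj_by g (conj_by (inv g) s \<otimes> z)" by simp
      then show "conj_by g z \<otimes> s = s \<otimes> conj_by g z"
        using g zc sc by (simp add: conj_by_mult conj_by_inv_cancel)
    qed (use g zc in simp)
    then have "conj_class G z \<subseteq> centralizer (generate G ?S)"
      using centralizer_generate[OF S] by (auto simp: conj_class_eq)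
    moreover have "conj_class G z \<subseteq> generate G ?S" using incl by (auto intro: generate.incl)
    ultimately have "comm_group (sub G (generate G (conj_class G z)))"
      using conj_class_closed[OF zc] by (intro comm_group_generate) (auto simp: centralizer_def)
    moreover have "z \<in> FC G" using z(1) H(1) by auto
    ultimately obtain N where "N \<lhd> G" "N \<noteq> {\<one>}" "N \<subseteq> generate G (conj_class G z)"
      "finite N \<or> (\<exists>n. sub G N \<cong> int_power n)"
      using abelian_normal_closure[of z] z(3) by blast
    then show ?thesis using incl H(1) by blast
  qed
qed

lemma conj_by_sub:
  assumes "subgroup H G" "h \<in> H"
  shows "group.conj_by (sub G H) h x = conj_by h x"
  using assms by (simp add: group.conj_by_def[OF subgroup_imp_group[OF assms(1)]] conj_by_def m_inv_consistent)

lemma FC_sub: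
  assumes "subgroup H G"
  shows "FC (sub G H) = {x \<in> H. finite ((\<lambda>h. conj_by h x) ` H)}"
  using group.conj_class_eq[OF subgroup_imp_group[OF assms]] conj_by_sub[OF assms]
  by (simp add: FC_def)

lemma normal_sub_iff:
  assumes "subgroup H G"
  shows "N \<lhd> sub G H \<longleftrightarrow>
    subgroup N (sub G H) \<and> (\<forall>h \<in> H. \<forall>x \<in> N. conj_by h x \<in> N)"
  using group.normal_iff_conj_by[OF subgroup_imp_group[OF assms]] conj_by_sub[OF assms] by simp

lemma not_icc_iff:
  assumes "carrier G \<noteq> {\<one>}"
  shows "\<not> icc G \<longleftrightarrow> (\<exists>x \<in> FC G. x \<noteq> \<one>)"
  using assms by (auto simp: icc_def FC_def)

text \<open>
  The commutator \<open>x\<^sup>-\<^sup>1 m\<^sup>-\<^sup>1 x m\<close> lies in both normal subgroups.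
\<close>
lemma normal_disjoint_centralizer:
  assumes M: "M \<lhd> G" and N: "N \<lhd> G" and "M \<inter> N = {\<one>}"
  shows "N \<subseteq> centralizer M"
proof
  fix x assume x: "x \<in> N"
  have sub: "subgroup M G" "subgroup N G" using M N by (simp_all add: normal_iff_conj_by)
  then have xc: "x \<in> carrier G" using x subgroup.mem_carrier by fastforce
  have "x \<otimes> m = m \<otimes> x" if m: "m \<in> M" for m
  proof -
    have mc: "m \<in> carrier G" using m sub subgroup.mem_carrier by fastforce
    have "inv x \<otimes> conj_by m x \<in> N"
      using N x mc sub by (simp add: normal_iff_conj_by subgroup.m_closed subgroup.m_inv_closed)
    moreover have "conj_by x (inv m) \<otimes> m \<in> M"
      using M m xc sub by (simp add: normal_iff_conj_by subgroup.m_closed subgroup.m_inv_closed)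
    moreover have "conj_by x (inv m) \<otimes> m = inv x \<otimes> conj_by m x"
      using xc mc by (simp add: conj_by_def m_assoc)
    ultimately have "inv x \<otimes> conj_by m x = \<one>" using assms(3) by auto
    then have "conj_by m x = x" using xc mc
      by (metis conj_by_closed inv_closed inv_equality inv_inv l_inv inv_unique)
    then show ?thesis using xc mc by (simp add: conj_by_eq_iff_commute)
  qed
  then show "x \<in> centralizer M" using xc by (simp add: centralizer_def)
qed

end

section \<open>Semidirect products\<close>

locale semidirect_product = group G for G (structure) +
  fixes K Q :: "'a set" and \<theta> :: "'a \<Rightarrow> 'a \<Rightarrow> 'a"
  assumes split_ext: "split_extension G K Q \<theta>"
begin

lemma
  shows normal_K: "K \<lhd> G" and subgroup_K: "subgroup K G" and subgroup_Q: "subgroup Q G"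
  using split_ext by (auto simp: split_extension_def normal_iff_conj_by)

lemma K_closed [simp]: "k \<in> K \<Longrightarrow> k \<in> carrier G"
  and Q_closed [simp]: "q \<in> Q \<Longrightarrow> q \<in> carrier G"
  using subgroup_K subgroup_Q subgroup.mem_carrier by fastforce+

lemma K_ops [simp]: "\<one> \<in> K" "k \<in> K \<Longrightarrow> inv k \<in> K" "\<lbrakk>k \<in> K; l \<in> K\<rbrakk> \<Longrightarrow> k \<otimes> l \<in> K"
  and Q_ops [simp]: "\<one> \<in> Q" "p \<in> Q \<Longrightarrow> inv p \<in> Q" "\<lbrakk>p \<in> Q; q \<in> Q\<rbrakk> \<Longrightarrow> p \<otimes> q \<in> Q"
  using subgroup_K subgroup_Q
  by (simp_all add: subgroup.one_closed subgroup.m_closed subgroup.m_inv_closed)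

lemma conj_by_K [simp]: "\<lbrakk>g \<in> carrier G; k \<in> K\<rbrakk> \<Longrightarrow> conj_by g k \<in> K"
  using normal_K by (simp add: normal_iff_conj_by)

lemma conj_by_Q [simp]: "\<lbrakk>p \<in> Q; q \<in> Q\<rbrakk> \<Longrightarrow> conj_by p q \<in> Q"
  by (simp add: conj_by_def)

lemma decompose:
  assumes "g \<in> carrier G"
  obtains k q where "k \<in> K" "q \<in> Q" "g = k \<otimes> q"
proof -
  have "g \<in> K <#> Q" using split_ext assms by (simp add: split_extension_def)
  then show thesis using that by (auto simp: set_mult_def)
qed

lemma decompose_unique:
  assumes "k \<in> K" "q \<in> Q" "l \<in> K" "p \<in> Q" "k \<otimes> q = l \<otimes> p"
  shows "k = l" "q = p"
proof -
  have "inv l \<otimes> k \<otimes> q = p"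
    using assms by (metis K_closed Q_closed inv_closed m_assoc mult_inv_cancel_left(2))
  then have "inv l \<otimes> k = p \<otimes> inv q"
    using assms by (metis K_closed Q_closed inv_closed inv_solve_right m_closed)
  moreover have "inv l \<otimes> k \<in> K" "p \<otimes> inv q \<in> Q" using assms by simp_all
  moreover have "K \<inter> Q = {\<one>}" using split_ext by (simp add: split_extension_def)
  ultimately have "inv l \<otimes> k = \<one>" "p \<otimes> inv q = \<one>" by auto
  then show "k = l" "q = p"
    using assms by (metis K_closed inv_closed inv_equality inv_inv, metis Q_closed inv_closed inv_equality inv_inv)
qed

lemma conj_action_eq: "conj_action G K g = restrict (conj_by g) K"
  by (auto simp: conj_action_def conj_by_def)

text \<open>
  Both sides are extensional on \<open>K\<close>, so they agree as functions and not only on \<open>K\<close>; this turns equations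
  in \<open>Aut K\<close> into statements about conjugation.
\<close>
lemma theta_eq_conj_action:
  assumes q: "q \<in> Q"
  shows "\<theta> q = conj_action G K q"
proof (rule extensionalityI[where A = K])
  have hom: "\<theta> \<in> hom (sub G Q) (Aut (sub G K))"
    and eq: "\<forall>q\<in>Q. \<forall>k\<in>K. inv q \<otimes> k \<otimes> q = \<theta> q k"
    using split_ext unfolding split_extension_def by blast+
  have "\<theta> q \<in> auto (sub G K)"
    using hom_in_carrier[OF hom, of q] q by (simp add: Aut_def)
  then show "\<theta> q \<in> extensional K" by (simp add: auto_def Bij_def)
  show "conj_action G K q \<in> extensional K" by (simp add: conj_action_def)
  show "\<theta> q k = conj_action G K q k" if "k \<in> K" for k
    using bspec[OF bspec[OF eq q] that] that by (simp only: conj_action_def restrict_apply' refl)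
qed

lemma conj_action_eq_iff:
  assumes "g \<in> carrier G" "h \<in> carrier G"
  shows "conj_action G K g = conj_action G K h \<longleftrightarrow> g \<otimes> inv h \<in> centralizer K"
proof -
  have "conj_action G K g = conj_action G K h \<longleftrightarrow> (\<forall>k \<in> K. conj_by g k = conj_by h k)"
    unfolding conj_action_eq by (metis restrict_apply' restrict_ext)
  also have "\<dots> \<longleftrightarrow> (\<forall>k \<in> K. conj_by (g \<otimes> inv h) k = k)"
  proof (rule ball_cong[OF refl])
    fix k assume k: "k \<in> K"
    have "conj_by (g \<otimes> inv h) k = conj_by (inv h) (conj_by g k)"
      "conj_by (inv h) (conj_by h k) = k"
      using assms k by (simp_all add: conj_by_conj_by)
    then show "conj_by g k = conj_by h k \<longleftrightarrow> conj_by (g \<otimes> inv h) k = k"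
      using assms k conj_by_inj[of "inv h" "conj_by g k" "conj_by h k"]
      by (metis K_closed conj_by_closed inv_closed)
  qed
  also have "\<dots> \<longleftrightarrow> g \<otimes> inv h \<in> centralizer K"
    using assms by (auto simp: centralizer_def conj_by_eq_iff_commute)
  finally show ?thesis .
qed

lemma orbit_conj_action: "x \<in> K \<Longrightarrow> orbit G (conj_action G K) x = conj_class G x"
  by (auto simp: orbit_def conj_class_eq conj_action_eq)

lemma orbit_theta: "c \<in> K \<Longrightarrow> orbit (sub G Q) \<theta> c = (\<lambda>q. conj_by q c) ` Q"
  unfolding orbit_def Setcompr_eq_image by (auto simp: theta_eq_conj_action conj_action_eq intro!: image_cong)

text \<open>
  An element \<open>c q\<close> centralizing \<open>K\<close> is moved only by the \<open>Q\<close>-part of a conjugator, and conjugation by \<open>p \<in> Q\<close>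
  acts on its two components separately. By uniqueness of the decomposition its class is the set of pairs
  \<open>(p\<^sup>-\<^sup>1 c p, p\<^sup>-\<^sup>1 q p)\<close>, which is finite exactly when both coordinates take finitely many values.
  For \<open>c = \<one>\<close> this links failure of injectivity of \<open>\<theta>\<close> to \<open>FC G\<close>, and in general it links twin subfactors to \<open>FC G\<close>.
\<close>
lemma FC_iff_of_centralizer:
  assumes c: "c \<in> K" and q: "q \<in> Q" and cent: "c \<otimes> q \<in> centralizer K"
  shows "c \<otimes> q \<in> FC G \<longleftrightarrow> finite ((\<lambda>p. conj_by p c) ` Q) \<and> q \<in> FC (sub G Q)"
proof -
  let ?x = "c \<otimes> q"
  have "conj_by (k \<otimes> p) ?x = conj_by p ?x" if "k \<in> K" "p \<in> Q" for k p
  proof -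
    have "conj_by k ?x = ?x"
      using cent that c q by (auto simp: centralizer_def conj_by_eq_iff_commute)
    then show ?thesis using that c q conj_by_conj_by[of k p ?x] by simp
  qed
  then have "conj_class G ?x = (\<lambda>p. conj_by p ?x) ` Q"
    unfolding conj_class_eq by (auto elim!: decompose)
  also have "\<dots> = (\<lambda>p. conj_by p c \<otimes> conj_by p q) ` Q"
    using c q by (auto simp: conj_by_mult)
  finally have cls: "conj_class G ?x = (\<lambda>p. conj_by p c \<otimes> conj_by p q) ` Q" .
  define pr where "pr x = (THE y. fst y \<in> K \<and> snd y \<in> Q \<and> x = fst y \<otimes> snd y)" for x
  have pr: "pr (k \<otimes> p) = (k, p)" if "k \<in> K" "p \<in> Q" for k p
    unfolding pr_def using that decompose_unique by (intro the_equality) (auto simp: prod_eq_iff)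
  have "finite (conj_class G ?x) \<longleftrightarrow> finite ((\<lambda>p. (conj_by p c, conj_by p q)) ` Q)"
  proof
    assume "finite (conj_class G ?x)"
    then have "finite (pr ` conj_class G ?x)" by simp
    moreover have "pr ` conj_class G ?x = (\<lambda>p. (conj_by p c, conj_by p q)) ` Q"
      unfolding cls image_image using c q pr by (intro image_cong) auto
    ultimately show "finite ((\<lambda>p. (conj_by p c, conj_by p q)) ` Q)" by simp
  next
    assume "finite ((\<lambda>p. (conj_by p c, conj_by p q)) ` Q)"
    then have "finite ((\<lambda>(u, v). u \<otimes> v) ` (\<lambda>p. (conj_by p c, conj_by p q)) ` Q)" by (rule finite_imageI)
    then show "finite (conj_class G ?x)" by (simp add: cls image_image)
  qed
  also have "\<dots> \<longleftrightarrow> finite ((\<lambda>p. conj_by p c) ` Q) \<and> finite ((\<lambda>p. conj_by p q) ` Q)"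
  proof
    assume f: "finite ((\<lambda>p. (conj_by p c, conj_by p q)) ` Q)"
    show "finite ((\<lambda>p. conj_by p c) ` Q) \<and> finite ((\<lambda>p. conj_by p q) ` Q)"
      using finite_imageI[OF f, of fst] finite_imageI[OF f, of snd] by (simp add: image_image)
  next
    assume "finite ((\<lambda>p. conj_by p c) ` Q) \<and> finite ((\<lambda>p. conj_by p q) ` Q)"
    then show "finite ((\<lambda>p. (conj_by p c, conj_by p q)) ` Q)"
      by (auto intro: finite_subset[of _ "(\<lambda>p. conj_by p c) ` Q \<times> (\<lambda>p. conj_by p q) ` Q"])
  qed
  finally show ?thesis using c q by (simp add: FC_def[of G] FC_sub[OF subgroup_Q])
qed

text \<open>
  Conjugating by \<open>q k\<close>, with the \<open>Q\<close>-part first, reaches finitely many elements \<open>d\<close> of the \<open>Q\<close>-orbit and then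
  their \<open>K\<close>-classes; these are finite because conjugation by \<open>q\<close> carries the \<open>K\<close>-class of \<open>c\<close> to that of
  its image. Consequently the \<open>K\<close>-side of a twin subfactor has to avoid \<open>FC K\<close> when \<open>FC G\<close> avoids \<open>K\<close>.
\<close>
lemma FC_of_finite_orbits:
  assumes c: "c \<in> FC (sub G K)" and fin: "finite ((\<lambda>q. conj_by q c) ` Q)"
  shows "c \<in> FC G"
proof -
  have cK: "c \<in> K" and finK: "finite ((\<lambda>k. conj_by k c) ` K)"
    using c by (simp_all add: FC_sub[OF subgroup_K])
  have finK_orbit: "finite ((\<lambda>k. conj_by k (conj_by q c)) ` K)" if q: "q \<in> Q" for q
  proof -
    have "conj_by k (conj_by q c) = conj_by q (conj_by (conj_by (inv q) k) c)" if "k \<in> K" for k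
    proof -
      have "conj_by (inv q) k \<otimes> q = q \<otimes> k"
        using that q by (simp add: conj_by_def m_assoc)
      then show ?thesis using that q cK by (simp add: conj_by_conj_by)
    qed
    then have "(\<lambda>k. conj_by k (conj_by q c)) ` K \<subseteq> conj_by q ` (\<lambda>k. conj_by k c) ` K"
      using q by auto
    then show ?thesis using finK by (meson finite_imageI finite_subset)
  qed
  have "conj_class G c \<subseteq> (\<Union>d \<in> (\<lambda>q. conj_by q c) ` Q. (\<lambda>k. conj_by k d) ` K)"
  proof
    fix y assume "y \<in> conj_class G c"
    then obtain g where g: "g \<in> carrier G" "y = conj_by g c" by (auto simp: conj_class_eq)
    \<comment> \<open>Decomposing the inverse puts the \<open>Q\<close>-part of \<open>g\<close> first.\<close>
    obtain k q where kq: "k \<in> K" "q \<in> Q" "inv g = k \<otimes> q"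
      by (rule decompose[OF inv_closed[OF g(1)]])
    then have "g = inv q \<otimes> inv k" using g by (metis K_closed Q_closed inv_inv inv_mult_group)
    then have "y = conj_by (inv k) (conj_by (inv q) c)"
      using kq cK g by (simp add: conj_by_conj_by)
    moreover have "inv k \<in> K" "inv q \<in> Q" using kq by simp_all
    ultimately show "y \<in> (\<Union>d \<in> (\<lambda>q. conj_by q c) ` Q. (\<lambda>k. conj_by k d) ` K)" by blast
  qed
  moreover have "finite (\<Union>d \<in> (\<lambda>q. conj_by q c) ` Q. (\<lambda>k. conj_by k d) ` K)"
    using fin finK_orbit by blast
  ultimately show ?thesis using cK by (auto simp: FC_def intro: finite_subset)
qed

lemma FC_of_normal_in_K:
  assumes N: "N \<lhd> sub G K" "N \<noteq> {\<one>}"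
    and stable: "\<forall>g \<in> carrier G. conj_action G K g ` N \<subseteq> N"
    and fin: "finite N \<or> (\<forall>x \<in> N. finite (orbit G (conj_action G K) x))"
  shows "\<exists>x \<in> FC G. x \<noteq> \<one>"
proof -
  have sub: "subgroup N (sub G K)" using N normal_sub_iff[OF subgroup_K] by blast
  then have NK: "N \<subseteq> K" "\<one> \<in> N" using subgroup.subset subgroup.one_closed by fastforce+
  then obtain x where x: "x \<in> N" "x \<noteq> \<one>" using N(2) by blast
  then have xK: "x \<in> K" using NK by auto
  have "conj_class G x \<subseteq> N"
    using stable x(1) xK by (auto simp: conj_class_eq conj_action_eq)
  then have "finite (conj_class G x)"
    using fin x(1) orbit_conj_action[OF xK] by (auto intro: finite_subset)
  then show ?thesis using x(2) xK by (auto simp: FC_def intro!: exI[of _ x])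
qed

lemma FC_of_noninjective:
  assumes "\<not> inj_on \<theta> (FC (sub G Q))"
  shows "\<exists>x \<in> FC G. x \<noteq> \<one>"
proof -
  obtain p q where pq: "p \<in> FC (sub G Q)" "q \<in> FC (sub G Q)" "\<theta> p = \<theta> q" "p \<noteq> q"
    using assms by (auto simp: inj_on_def)
  have pqQ: "p \<in> Q" "q \<in> Q" using pq by (auto simp: FC_def)
  have "subgroup (FC (sub G Q)) (sub G Q)"
    using group.FC_normal[OF subgroup_imp_group[OF subgroup_Q]] normal_sub_iff[OF subgroup_Q] by blast
  then have "subgroup (FC (sub G Q)) G"
    by (rule incl_subgroup[OF subgroup_Q])
  then have FC: "p \<otimes> inv q \<in> FC (sub G Q)"
    using pq by (simp add: subgroup.m_closed subgroup.m_inv_closed)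
  have "p \<otimes> inv q \<in> centralizer K"
    using pq pqQ conj_action_eq_iff by (simp add: theta_eq_conj_action)
  then have "p \<otimes> inv q \<in> FC G"
    using FC_iff_of_centralizer[of \<one> "p \<otimes> inv q"] FC pqQ by (simp add: image_constant_conv)
  moreover have "p \<otimes> inv q \<noteq> \<one>"
    using pq(4) pqQ by (metis Q_closed inv_closed inv_equality inv_inv)
  ultimately show ?thesis by blast
qed

lemma FC_of_twin:
  assumes "twin_FC_subfactor G K Q \<theta> C C'"
  shows "\<exists>x \<in> FC G. x \<noteq> \<one>"
proof -
  have C: "subgroup C (sub G K)" "\<And>c. c \<in> C \<Longrightarrow> finite (orbit (sub G Q) \<theta> c)"
      "C \<noteq> {\<one>}"
    and C': "C' \<lhd> sub G Q" "C' \<subseteq> FC (sub G Q)"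
    and eq: "conj_action G K ` C = \<theta> ` C'"
    using assms unfolding twin_FC_subfactor_def by simp_all
  have CK: "C \<subseteq> K" "\<one> \<in> C" using subgroup.subset[OF C(1)] subgroup.one_closed[OF C(1)] by simp_all
  then obtain c where c: "c \<in> C" "c \<noteq> \<one>" using C(3) by blast
  then obtain q where q: "q \<in> C'" "conj_action G K c = \<theta> q" using eq by blast
  have cq: "c \<in> K" "q \<in> Q" using c q CK C' by (auto simp: FC_def)
  have sub: "subgroup C' G"
    using C'(1) unfolding normal_sub_iff[OF subgroup_Q] by (blast intro: incl_subgroup[OF subgroup_Q])
  have "inv q \<in> FC (sub G Q)" using C'(2) subgroup.m_inv_closed[OF sub q(1)] by auto
  moreover have "c \<otimes> inv q \<in> centralizer K"
    using q cq conj_action_eq_iff by (simp add: theta_eq_conj_action)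
  ultimately have "c \<otimes> inv q \<in> FC G"
    using FC_iff_of_centralizer[of c "inv q"] cq C(2)[OF c(1)] orbit_theta by simp
  moreover have "c \<otimes> inv q \<noteq> \<one>"
    using decompose_unique(1)[of c "inv q" \<one> \<one>] c(2) cq by auto
  ultimately show ?thesis by blast
qed

text \<open>
  Since \<open>N\<close> and \<open>K\<close> commute, the components \<open>c\<close> and \<open>q\<close> of an element \<open>c q\<^sup>-\<^sup>1\<close> of \<open>N\<close> act alike on \<open>K\<close>, and
  they form subgroups \<open>C\<close> and \<open>C'\<close>. Finiteness of the orbits of \<open>c\<close> and of the class of \<open>q\<close> is read off from
  \<open>c q\<^sup>-\<^sup>1 \<in> FC G\<close>. Injectivity of \<open>\<theta>\<close> makes \<open>c\<close> determine \<open>q\<close>, so \<open>N\<close> projects bijectively to \<open>C\<close>;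
  as this projection reverses products, it is followed by inversion to give an isomorphism, which
  transfers the size condition from \<open>N\<close> to \<open>C\<close>.
\<close>
lemma twin_of_normal:
  assumes N: "N \<lhd> G" "N \<noteq> {\<one>}" "N \<subseteq> FC G"
    and size: "finite N \<or> (\<exists>n. sub G N \<cong> int_power n)"
    and triv: "FC G \<inter> K = {\<one>}" and inj: "inj_on \<theta> (FC (sub G Q))"
  shows "\<exists>C C'. twin_FC_subfactor G K Q \<theta> C C'"
proof -
  define C where "C = {c \<in> K. \<exists>q \<in> Q. c \<otimes> inv q \<in> N}"
  define C' where "C' = {q \<in> Q. \<exists>c \<in> K. c \<otimes> inv q \<in> N}"
  have subN: "subgroup N G" and conjN: "\<And>g x. \<lbrakk>g \<in> carrier G; x \<in> N\<rbrakk> \<Longrightarrow> conj_by g x \<in> N"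
    using N(1) unfolding normal_iff_conj_by by blast+
  have N1: "\<one> \<in> N" using subN by (rule subgroup.one_closed)
  have "K \<inter> N = {\<one>}" using triv N(3) N1 by auto
  then have cent: "x \<in> centralizer K" if "x \<in> N" for x
    using normal_disjoint_centralizer[OF normal_K N(1)] that by auto
  have fin: "finite ((\<lambda>p. conj_by p c) ` Q)" "inv q \<in> FC (sub G Q)"
    if "c \<in> K" "q \<in> Q" "c \<otimes> inv q \<in> N" for c q
    using FC_iff_of_centralizer[of c "inv q"] that cent N(3) by auto
  \<comment> \<open>Moving \<open>d\<close> past \<open>c q\<^sup>-\<^sup>1\<close> reverses the order of the factors in both components.\<close>
  have mult: "(d \<otimes> c) \<otimes> inv (p \<otimes> q) = (c \<otimes> inv q) \<otimes> (d \<otimes> inv p)"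
    if "c \<in> K" "q \<in> Q" "c \<otimes> inv q \<in> N" "d \<in> K" "p \<in> Q" for c q d p
  proof -
    have "c \<otimes> inv q \<otimes> d = d \<otimes> (c \<otimes> inv q)"
      using cent[OF that(3)] that(4) by (simp add: centralizer_def)
    then have "c \<otimes> inv q \<otimes> d \<otimes> inv p = d \<otimes> (c \<otimes> inv q) \<otimes> inv p" by simp
    then show ?thesis using that by (simp add: m_assoc inv_mult_group)
  qed
  have inverse: "inv c \<otimes> inv (inv q) \<in> N" if "c \<in> K" "q \<in> Q" "c \<otimes> inv q \<in> N" for c q
  proof -
    \<comment> \<open>The inverse \<open>q c\<^sup>-\<^sup>1\<close> has its components in the wrong order; conjugation by \<open>c\<close> swaps them.\<close>
    have "conj_by c (inv (c \<otimes> inv q)) \<in> N"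
      using that by (intro conjN subgroup.m_inv_closed[OF subN]) auto
    moreover have "conj_by c (inv (c \<otimes> inv q)) = inv c \<otimes> inv (inv q)"
      using that by (simp add: conj_by_def m_assoc inv_mult_group)
    ultimately show ?thesis by simp
  qed
  have prod: "(d \<otimes> c) \<otimes> inv (p \<otimes> q) \<in> N"
    if "c \<in> K" "q \<in> Q" "c \<otimes> inv q \<in> N" "d \<in> K" "p \<in> Q" "d \<otimes> inv p \<in> N" for c q d p
    using mult[OF that(1-5)] that by (simp add: subgroup.m_closed[OF subN])
  have conj: "conj_by p c \<otimes> inv (conj_by p q) \<in> N"
    if "c \<in> K" "q \<in> Q" "c \<otimes> inv q \<in> N" "p \<in> Q" for c q p
    using conjN[of p "c \<otimes> inv q"] that by (simp add: conj_by_mult conj_by_inv)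
  have memI: "c \<in> C" "q \<in> C'" if "c \<in> K" "q \<in> Q" "c \<otimes> inv q \<in> N" for c q
    using that by (auto simp: C_def C'_def)
  have CE: "\<exists>q. c \<in> K \<and> q \<in> Q \<and> c \<otimes> inv q \<in> N" if "c \<in> C" for c
    using that by (auto simp: C_def)
  have C'E: "\<exists>c. c \<in> K \<and> q \<in> Q \<and> c \<otimes> inv q \<in> N" if "q \<in> C'" for q
    using that by (auto simp: C'_def)
  have subC: "subgroup C G"
  proof (rule subgroup.intro)
    show "C \<subseteq> carrier G" by (auto simp: C_def)
    show "\<one> \<in> C" using N1 by (intro memI(1)[of _ \<one>]) auto
    fix c assume "c \<in> C"
    then obtain q where c: "c \<in> K" "q \<in> Q" "c \<otimes> inv q \<in> N" using CE by blast
    show "inv c \<in> C" using c inverse[OF c] by (intro memI(1)[of _ "inv q"]) auto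
    fix d assume "d \<in> C"
    then obtain p where d: "d \<in> K" "p \<in> Q" "d \<otimes> inv p \<in> N" using CE by blast
    show "c \<otimes> d \<in> C" using c d prod[OF d c] by (intro memI(1)[of _ "q \<otimes> p"]) auto
  qed
  have subC': "subgroup C' G"
  proof (rule subgroup.intro)
    show "C' \<subseteq> carrier G" by (auto simp: C'_def)
    show "\<one> \<in> C'" using N1 by (intro memI(2)[of \<one>]) auto
    fix q assume "q \<in> C'"
    then obtain c where c: "c \<in> K" "q \<in> Q" "c \<otimes> inv q \<in> N" using C'E by blast
    show "inv q \<in> C'" using c inverse[OF c] by (intro memI(2)[of "inv c"]) auto
    fix p assume "p \<in> C'"
    then obtain d where d: "d \<in> K" "p \<in> Q" "d \<otimes> inv p \<in> N" using C'E by blast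
    show "q \<otimes> p \<in> C'" using c d prod[OF d c] by (intro memI(2)[of "c \<otimes> d"]) auto
  qed
  have same_action: "conj_action G K c = \<theta> q" if "c \<in> K" "q \<in> Q" "c \<otimes> inv q \<in> N" for c q
    using that cent conj_action_eq_iff by (simp add: theta_eq_conj_action)
  have C'FC: "C' \<subseteq> FC (sub G Q)"
  proof
    fix q assume q: "q \<in> C'"
    then have "inv q \<in> C'" by (rule subgroup.m_inv_closed[OF subC'])
    then obtain c where "c \<in> K" "inv q \<in> Q" "c \<otimes> inv (inv q) \<in> N" by (auto simp: C'_def)
    then have "inv (inv q) \<in> FC (sub G Q)" by (intro fin(2))
    then show "q \<in> FC (sub G Q)" using q by (simp add: C'_def)
  qed
  have injC': "inj_on \<theta> C'" using inj C'FC by (rule inj_on_subset)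
  have unique_q: "p = q" if "c \<in> K" "p \<in> Q" "q \<in> Q" "c \<otimes> inv p \<in> N" "c \<otimes> inv q \<in> N" for c p q
    using that same_action[of c p] same_action[of c q] injC' by (auto simp: inj_on_def C'_def)
  have C_FC: "C \<inter> FC (sub G K) \<subseteq> {\<one>}"
  proof
    fix c assume c: "c \<in> C \<inter> FC (sub G K)"
    then have "c \<in> FC G" using fin(1) by (auto simp: C_def intro!: FC_of_finite_orbits)
    then show "c \<in> {\<one>}" using triv c by (auto simp: C_def)
  qed
  have oneFC: "\<one> \<in> FC (sub G K)"
    by (simp add: FC_sub[OF subgroup_K] image_constant_conv)
  \<comment> \<open>If \<open>c\<close> and \<open>d\<close> act alike on \<open>K\<close>, then \<open>c d\<^sup>-\<^sup>1\<close> is central in \<open>K\<close> and hence in \<open>FC K\<close>.\<close>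
  have injC: "inj_on (conj_action G K) C"
  proof (rule inj_onI)
    fix c d assume cd: "c \<in> C" "d \<in> C" "conj_action G K c = conj_action G K d"
    then have K: "c \<in> K" "d \<in> K" by (auto simp: C_def)
    have mem: "c \<otimes> inv d \<in> C" using cd subC by (simp add: subgroup.m_closed subgroup.m_inv_closed)
    have "c \<otimes> inv d \<in> centralizer K" using cd K conj_action_eq_iff by simp
    then have "conj_by k (c \<otimes> inv d) = c \<otimes> inv d" if "k \<in> K" for k
      using that K by (auto simp: centralizer_def conj_by_eq_iff_commute)
    then have "(\<lambda>k. conj_by k (c \<otimes> inv d)) ` K \<subseteq> {c \<otimes> inv d}" by auto
    then have "c \<otimes> inv d \<in> FC (sub G K)"
      using K by (auto simp: FC_sub[OF subgroup_K] intro: finite_subset)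
    then have "c \<otimes> inv d = \<one>" using mem C_FC by auto
    then show "c = d" using K by (metis K_closed inv_closed inv_equality inv_inv)
  qed
  have decomp: "\<exists>c q. c \<in> K \<and> q \<in> Q \<and> x = c \<otimes> inv q \<and> c \<otimes> inv q \<in> N" if x: "x \<in> N" for x
  proof -
    obtain k q where "k \<in> K" "q \<in> Q" "x = k \<otimes> q"
      by (rule decompose[OF subgroup.mem_carrier[OF subN x]])
    then show ?thesis using x by (intro exI[of _ k] exI[of _ "inv q"]) auto
  qed
  define \<kappa> where "\<kappa> x = (THE c. c \<in> K \<and> (\<exists>q \<in> Q. x = c \<otimes> q))" for x
  have \<kappa>: "\<kappa> (c \<otimes> inv q) = c" if "c \<in> K" "q \<in> Q" for c q
    unfolding \<kappa>_def
  proof (rule the_equality)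
    show "c \<in> K \<and> (\<exists>p\<in>Q. c \<otimes> inv q = c \<otimes> p)" using that by auto
    show "d = c" if "d \<in> K \<and> (\<exists>p\<in>Q. c \<otimes> inv q = d \<otimes> p)" for d
      using that \<open>c \<in> K\<close> \<open>q \<in> Q\<close> decompose_unique(1)[of c "inv q" d] by auto
  qed
  have iso: "(\<lambda>x. inv (\<kappa> x)) \<in> iso (sub G N) (sub G C)"
  proof (rule isoI)
    show hom: "(\<lambda>x. inv (\<kappa> x)) \<in> hom (sub G N) (sub G C)"
    proof (rule homI)
      fix x assume "x \<in> carrier (sub G N)"
      then have "x \<in> N" by simp
      then obtain c q where "c \<in> K" "q \<in> Q" "x = c \<otimes> inv q" "c \<otimes> inv q \<in> N"
        using decomp by blast
      then show "inv (\<kappa> x) \<in> carrier (sub G C)"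
        using \<kappa> subgroup.m_inv_closed[OF subC] memI(1) by simp
    next
      fix x y assume "x \<in> carrier (sub G N)" "y \<in> carrier (sub G N)"
      then have "x \<in> N" "y \<in> N" by simp_all
      then obtain c q d p where cd: "c \<in> K" "q \<in> Q" "x = c \<otimes> inv q" "c \<otimes> inv q \<in> N"
        "d \<in> K" "p \<in> Q" "y = d \<otimes> inv p" "d \<otimes> inv p \<in> N"
        using decomp[of x] decomp[of y] by blast
      then have "x \<otimes> y = (d \<otimes> c) \<otimes> inv (p \<otimes> q)" using mult by simp
      then have "\<kappa> (x \<otimes> y) = d \<otimes> c" using \<kappa>[of "d \<otimes> c" "p \<otimes> q"] cd by simp
      then show "inv (\<kappa> (x \<otimes>\<^bsub>sub G N\<^esub> y))
          = inv (\<kappa> x) \<otimes>\<^bsub>sub G C\<^esub> inv (\<kappa> y)"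
        using cd \<kappa> by (simp add: inv_mult_group)
    qed
    show "bij_betw (\<lambda>x. inv (\<kappa> x)) (carrier (sub G N)) (carrier (sub G C))"
    proof (rule bij_betw_imageI)
      show "inj_on (\<lambda>x. inv (\<kappa> x)) (carrier (sub G N))"
      proof (rule inj_onI)
        fix x y assume xy: "x \<in> carrier (sub G N)" "y \<in> carrier (sub G N)"
          "inv (\<kappa> x) = inv (\<kappa> y)"
        then have "x \<in> N" "y \<in> N" by simp_all
        then obtain c q d p where cd: "c \<in> K" "q \<in> Q" "x = c \<otimes> inv q" "c \<otimes> inv q \<in> N"
          "d \<in> K" "p \<in> Q" "y = d \<otimes> inv p" "d \<otimes> inv p \<in> N"
          using decomp[of x] decomp[of y] by blast
        then have "inv c = inv d" using \<kappa> xy(3) by simp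
        then have "c = d" using cd(1,5) by (metis K_closed inv_inv)
        then show "x = y" using unique_q[of c p q] cd by auto
      qed
      show "(\<lambda>x. inv (\<kappa> x)) ` carrier (sub G N) = carrier (sub G C)"
      proof
        show "(\<lambda>x. inv (\<kappa> x)) ` carrier (sub G N) \<subseteq> carrier (sub G C)"
          using hom_in_carrier[OF hom] by blast
        show "carrier (sub G C) \<subseteq> (\<lambda>x. inv (\<kappa> x)) ` carrier (sub G N)"
        proof
          fix c assume "c \<in> carrier (sub G C)"
          then have "inv c \<in> C" "c \<in> K" using subgroup.m_inv_closed[OF subC] CE by auto
          then obtain q where "q \<in> Q" "inv c \<otimes> inv q \<in> N" using CE by blast
          then show "c \<in> (\<lambda>x. inv (\<kappa> x)) ` carrier (sub G N)"
            using \<kappa>[of "inv c" q] \<open>c \<in> K\<close> by (intro image_eqI[of _ _ "inv c \<otimes> inv q"]) auto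
        qed
      qed
    qed
  qed
  have sizeC: "finite C \<or> (\<exists>n. sub G C \<cong> int_power n)"
  proof -
    have 1: "sub G N \<cong> sub G C" using iso by (rule is_isoI)
    then have 2: "sub G C \<cong> sub G N"
      by (rule group.iso_sym[OF subgroup_imp_group[OF subN]])
    show ?thesis using size iso_finite[OF 1] iso_trans[OF 2] by auto
  qed
  have nontriv: "C \<noteq> {\<one>}"
  proof
    assume "C = {\<one>}"
    then have "finite C" "card C = 1" by simp_all
    moreover have "bij_betw (\<lambda>x. inv (\<kappa> x)) N C" using iso by (simp add: iso_def)
    ultimately have "card N = 1" using bij_betw_same_card by fastforce
    then show False using N(2) N1 by (auto simp: card_1_singleton_iff)
  qed
  have "twin_FC_subfactor G K Q \<theta> C C'"
    unfolding twin_FC_subfactor_def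
  proof (intro conjI)
    show "subgroup C (sub G K)"
      by (rule subgroup_incl[OF subC subgroup_K]) (auto simp: C_def)
    show "C \<inter> FC (sub G K) = {\<one>}"
      using C_FC oneFC subgroup.one_closed[OF subC] by auto
    show "\<forall>q\<in>Q. \<theta> q ` C \<subseteq> C"
    proof (intro ballI image_subsetI)
      fix p c assume p: "p \<in> Q" and "c \<in> C"
      then obtain q where c: "c \<in> K" "q \<in> Q" "c \<otimes> inv q \<in> N" using CE by blast
      show "\<theta> p c \<in> C"
        using p c conj[OF c p] memI(1)[of "conj_by p c" "conj_by p q"]
        by (simp add: theta_eq_conj_action conj_action_eq)
    qed
    show "\<forall>c\<in>C. finite (orbit (sub G Q) \<theta> c)"
      using fin(1) by (auto simp: C_def orbit_theta)
    show "C' \<lhd> sub G Q"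
      unfolding normal_sub_iff[OF subgroup_Q]
    proof
      show "subgroup C' (sub G Q)"
        by (rule subgroup_incl[OF subC' subgroup_Q]) (auto simp: C'_def)
      show "\<forall>p\<in>Q. \<forall>q\<in>C'. conj_by p q \<in> C'"
      proof (intro ballI)
        fix p q assume p: "p \<in> Q" and "q \<in> C'"
        then obtain c where c: "c \<in> K" "q \<in> Q" "c \<otimes> inv q \<in> N" using C'E by blast
        show "conj_by p q \<in> C'"
          using p c conj[OF c p] memI(2)[of "conj_by p c" "conj_by p q"] by simp
      qed
    qed
    show "conj_action G K ` C = \<theta> ` C'"
    proof
      show "conj_action G K ` C \<subseteq> \<theta> ` C'" using same_action memI(2) CE by blast
      show "\<theta> ` C' \<subseteq> conj_action G K ` C"
        using same_action[symmetric] memI(1) C'E by blast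
    qed
  qed (use C'FC injC' injC nontriv sizeC in auto)
  then show ?thesis by blast
qed

end

section \<open>Characterization of icc split extensions\<close>

theorem theorem3:
  fixes G :: "('a, 'm) monoid_scheme" and K Q :: "'a set" and \<theta> :: "'a \<Rightarrow> 'a \<Rightarrow> 'a"
  assumes "split_extension G K Q \<theta>"
    and "carrier G \<noteq> {\<one>\<^bsub>G\<^esub>}"
  shows "\<not> icc G \<longleftrightarrow>
    (\<exists>N. N \<lhd> sub G K \<and> N \<noteq> {\<one>\<^bsub>G\<^esub>} \<and>
         (\<forall>g \<in> carrier G. conj_action G K g ` N \<subseteq> N) \<and>
         (finite N \<or>
          (\<exists>n. sub G N \<cong> int_power n) \<and> (\<forall>x \<in> N. finite (orbit G (conj_action G K) x)))) \<or>
    \<not> inj_on \<theta> (FC (sub G Q)) \<or>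
    (\<exists>C C'. twin_FC_subfactor G K Q \<theta> C C')"
    (is "_ \<longleftrightarrow> ?i \<or> ?iia \<or> ?iib")
proof -
  interpret group G using assms(1) by (simp add: split_extension_def)
  interpret semidirect_product G K Q \<theta> by unfold_locales (rule assms(1))
  have "(\<exists>x \<in> FC G. x \<noteq> \<one>\<^bsub>G\<^esub>) \<longleftrightarrow> ?i \<or> ?iia \<or> ?iib"
  proof
    assume "?i \<or> ?iia \<or> ?iib"
    then show "\<exists>x \<in> FC G. x \<noteq> \<one>\<^bsub>G\<^esub>"
      using FC_of_normal_in_K FC_of_noninjective FC_of_twin by blast
  next
    assume ex: "\<exists>x \<in> FC G. x \<noteq> \<one>\<^bsub>G\<^esub>"
    have "?i \<or> ?iib" if inj: "\<not> ?iia"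
    proof (cases "FC G \<inter> K = {\<one>\<^bsub>G\<^esub>}")
      case True
      obtain x where x: "x \<in> FC G" "x \<noteq> \<one>\<^bsub>G\<^esub>" using ex by blast
      then obtain N where "N \<lhd> G" "N \<noteq> {\<one>\<^bsub>G\<^esub>}" "N \<subseteq> FC G"
        "finite N \<or> (\<exists>n. sub G N \<cong> int_power n)"
        using FC_element_normal_subgroup[OF x x(1) FC_normal] unfolding Int_absorb by blast
      then have ?iib using True inj by (intro twin_of_normal) auto
      then show ?thesis ..
    next
      case False
      moreover have "\<one>\<^bsub>G\<^esub> \<in> FC G \<inter> K"
        using FC_normal subgroup.one_closed by (auto simp: normal_iff_conj_by)
      ultimately obtain x where x: "x \<in> FC G" "x \<noteq> \<one>\<^bsub>G\<^esub>" "x \<in> K" by blast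
      then obtain N where N: "N \<lhd> G" "N \<noteq> {\<one>\<^bsub>G\<^esub>}" "N \<subseteq> FC G \<inter> K"
        "finite N \<or> (\<exists>n. sub G N \<cong> int_power n)"
        using FC_element_normal_subgroup[OF x normal_K] by blast
      then have conj: "conj_by g y \<in> N" if "g \<in> carrier G" "y \<in> N" for g y
        using that by (simp add: normal_iff_conj_by)
      have "N \<lhd> sub G K"
        unfolding normal_sub_iff[OF subgroup_K]
        using N conj subgroup_incl[OF _ subgroup_K] by (auto simp: normal_iff_conj_by)
      moreover have "\<forall>g \<in> carrier G. conj_action G K g ` N \<subseteq> N"
        using conj N(3) by (auto simp: conj_action_eq)
      moreover have "\<forall>x \<in> N. finite (orbit G (conj_action G K) x)"
      proof
        fix y assume "y \<in> N"
        then have "y \<in> K" "finite (conj_class G y)" using N(3) by (auto simp: FC_def)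
        then show "finite (orbit G (conj_action G K) y)" by (simp add: orbit_conj_action)
      qed
      ultimately have ?i using N(2,4) by blast
      then show ?thesis ..
    qed
    then show "?i \<or> ?iia \<or> ?iib" by blast
  qed
  then show ?thesis using not_icc_iff[OF assms(2)] by simp
qed

end
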